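(* There is a deterministic algorithm such that the following holds. Given an $n$-vertex interval graph $G$ in the form of an RDV representation $(T,t,b)$ of $G$ in which the host tree $T$ is a path (rooted at one of its ends) with $O(n)$ nodes, the algorithm outputs a minimum dominating set of $G$ in $O(n)$ time.
   Context: All graphs are finite and simple. A set $S$ of vertices of a graph $G$ is dominating if every vertex of $G$ is in $S$ or adjacent to a vertex of $S$; a minimum dominating set is one of smallest cardinality. An interval graph is the intersection graph of finitely many intervals of the real line. An RDV representation $(T,t,b)$ of a graph $G$ consists of a rooted tree $T$ (the host tree; its vertices are called nodes) and, for every vertex $z$ of $G$, a top node $t(z)$ and a bottom node $b(z)$ of $T$ such that $b(z)$ is a descendant of $t(z)$ (possibly $b(z)=t(z)$). Let $T(z)$ be the path in $T$ between $t(z)$ and $b(z)$ (a downward path). It is required that for any two distinct vertices $z,w$ of $G$, $(z,w)$ is an edge of $G$ if and only if $T(z)$ and $T(w)$ share at least one node of $T$. The input is the rooted tree $T$ together with the node pair $(t(z),b(z))$ for each vertex $z$; the edges of $G$ are not listed explicitly. When $T$ is a path rooted at one end, identifying each node with its distance from the root turns $T(z)$ into the integer interval $[t(z),b(z)]$. Running time is measured in the standard unit-cost word-RAM model with words of $\Theta(\log n)$ bits. *)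

theory Defs
  imports "HOL-Analysis.Analysis"
begin

section \<open>Graphs\<close>

definition simple_graph :: "'a set \<Rightarrow> ('a \<Rightarrow> 'a \<Rightarrow> bool) \<Rightarrow> bool" where
  "simple_graph V E \<longleftrightarrow>
     finite V \<and> (\<forall>u v. E u v \<longrightarrow> u \<in> V \<and> v \<in> V) \<and> symp E \<and> irreflp E"

definition interval_graph :: "'a set \<Rightarrow> ('a \<Rightarrow> 'a \<Rightarrow> bool) \<Rightarrow> bool" where
  "interval_graph V E \<longleftrightarrow> simple_graph V E \<and>
     (\<exists>I :: 'a \<Rightarrow> real set.
        (\<forall>v\<in>V. is_interval (I v) \<and> I v \<noteq> {}) \<and>
        (\<forall>u\<in>V. \<forall>v\<in>V. u \<noteq> v \<longrightarrow> (E u v \<longleftrightarrow> I u \<inter> I v \<noteq> {})))"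

definition dominating_set :: "'a set \<Rightarrow> ('a \<Rightarrow> 'a \<Rightarrow> bool) \<Rightarrow> 'a set \<Rightarrow> bool" where
  "dominating_set V E S \<longleftrightarrow> S \<subseteq> V \<and> (\<forall>v\<in>V. v \<in> S \<or> (\<exists>u\<in>S. E u v))"

definition minimum_dominating_set :: "'a set \<Rightarrow> ('a \<Rightarrow> 'a \<Rightarrow> bool) \<Rightarrow> 'a set \<Rightarrow> bool" where
  "minimum_dominating_set V E S \<longleftrightarrow>
     dominating_set V E S \<and> (\<forall>S'. dominating_set V E S' \<longrightarrow> card S \<le> card S')"


section \<open>Rooted trees and RDV representations\<close>

text \<open>
  A rooted tree is given by its parent map; its edges are the pairs \<open>{v, parent T v}\<close> for the
  nodes \<open>v \<noteq> root_node T\<close>.  By convention the root is its own parent.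
\<close>

record 'n rtree =
  nodes :: "'n set"
  root_node :: 'n
  parent :: "'n \<Rightarrow> 'n"

definition rooted_tree :: "'n rtree \<Rightarrow> bool" where
  "rooted_tree T \<longleftrightarrow>
     finite (nodes T) \<and> root_node T \<in> nodes T \<and> parent T (root_node T) = root_node T \<and>
     (\<forall>v\<in>nodes T. parent T v \<in> nodes T \<and> (\<exists>k. (parent T ^^ k) v = root_node T))"

definition descendant :: "'n rtree \<Rightarrow> 'n \<Rightarrow> 'n \<Rightarrow> bool" where
  "descendant T v u \<longleftrightarrow> v \<in> nodes T \<and> (\<exists>k. (parent T ^^ k) v = u)"

text \<open>The nodes of the path between \<open>u\<close> and its descendant \<open>v\<close>.\<close>

definition downward_path :: "'n rtree \<Rightarrow> 'n \<Rightarrow> 'n \<Rightarrow> 'n set" where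
  "downward_path T u v = {x. descendant T x u \<and> descendant T v x}"

definition rdv_representation ::
  "'n rtree \<Rightarrow> ('a \<Rightarrow> 'n) \<Rightarrow> ('a \<Rightarrow> 'n) \<Rightarrow> 'a set \<Rightarrow> ('a \<Rightarrow> 'a \<Rightarrow> bool) \<Rightarrow> bool" where
  "rdv_representation T t b V E \<longleftrightarrow>
     rooted_tree T \<and>
     (\<forall>z\<in>V. t z \<in> nodes T \<and> b z \<in> nodes T \<and> descendant T (b z) (t z)) \<and>
     (\<forall>z\<in>V. \<forall>w\<in>V. z \<noteq> w \<longrightarrow>
        (E z w \<longleftrightarrow> downward_path T (t z) (b z) \<inter> downward_path T (t w) (b w) \<noteq> {}))"

definition path_rooted_at_end :: "'n rtree \<Rightarrow> bool" where
  "path_rooted_at_end T \<longleftrightarrow> rooted_tree T \<and>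
     (\<exists>xs. distinct xs \<and> xs \<noteq> [] \<and> set xs = nodes T \<and> hd xs = root_node T \<and>
        (\<forall>i. Suc i < length xs \<longrightarrow> parent T (xs ! Suc i) = xs ! i))"


section \<open>The unit-cost word RAM\<close>

text \<open>
  A machine with word length \<open>w\<close> computes with the numbers below \<open>2 ^ w\<close>, all arithmetic being
  modulo \<open>2 ^ w\<close>.  Since \<open>w\<close> varies with the size of the input, words are represented as natural
  numbers and every result is truncated by \<open>take_bit w\<close>.  A program is a fixed finite list of
  instructions; in particular it depends neither on the input nor on \<open>w\<close>, and it mentions only
  finitely many registers.
\<close>

datatype binop = ADD | SUB | MUL | DIV | MOD | AND | OR | XOR | SHL | SHR

primrec binop_val :: "nat \<Rightarrow> binop \<Rightarrow> nat \<Rightarrow> nat \<Rightarrow> nat" where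
  "binop_val w ADD x y = take_bit w (x + y)"
| "binop_val w SUB x y = take_bit w (x + 2 ^ w - y)"
| "binop_val w MUL x y = take_bit w (x * y)"
| "binop_val w DIV x y = take_bit w (x div y)"
| "binop_val w MOD x y = take_bit w (x mod y)"
| "binop_val w AND x y = take_bit w (and x y)"
| "binop_val w OR x y = take_bit w (or x y)"
| "binop_val w XOR x y = take_bit w (xor x y)"
| "binop_val w SHL x y = take_bit w (push_bit y x)"
| "binop_val w SHR x y = take_bit w (drop_bit y x)"

type_synonym reg = nat

datatype instr =
    Const reg nat
  | Move reg reg
  | Bin binop reg reg reg
  | Load reg reg
  | Store reg reg
  | Jump nat
  | JumpEq reg reg nat
  | JumpLess reg reg nat
  | Halt

record ram_state =
  pc :: nat
  regs :: "reg \<Rightarrow> nat"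
  mem :: "nat \<Rightarrow> nat"

definition set_reg :: "reg \<Rightarrow> nat \<Rightarrow> ram_state \<Rightarrow> ram_state" where
  "set_reg r x s = s\<lparr>pc := Suc (pc s), regs := (regs s)(r := x)\<rparr>"

primrec exec :: "nat \<Rightarrow> instr \<Rightarrow> ram_state \<Rightarrow> ram_state" where
  "exec w (Const r c) s = set_reg r (take_bit w c) s"
| "exec w (Move r r1) s = set_reg r (regs s r1) s"
| "exec w (Bin f r r1 r2) s = set_reg r (binop_val w f (regs s r1) (regs s r2)) s"
| "exec w (Load r a) s = set_reg r (mem s (regs s a)) s"
| "exec w (Store a r) s = s\<lparr>pc := Suc (pc s), mem := (mem s)(regs s a := regs s r)\<rparr>"
| "exec w (Jump l) s = s\<lparr>pc := l\<rparr>"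
| "exec w (JumpEq r1 r2 l) s = s\<lparr>pc := (if regs s r1 = regs s r2 then l else Suc (pc s))\<rparr>"
| "exec w (JumpLess r1 r2 l) s = s\<lparr>pc := (if regs s r1 < regs s r2 then l else Suc (pc s))\<rparr>"
| "exec w Halt s = s"

definition halted :: "instr list \<Rightarrow> ram_state \<Rightarrow> bool" where
  "halted P s \<longleftrightarrow> length P \<le> pc s \<or> P ! pc s = Halt"

definition step :: "nat \<Rightarrow> instr list \<Rightarrow> ram_state \<Rightarrow> ram_state" where
  "step w P s = (if halted P s then s else exec w (P ! pc s) s)"

text \<open>The input occupies the memory from address 0 on; all other cells and all registers are 0.\<close>

definition init_state :: "nat list \<Rightarrow> ram_state" where
  "init_state xs =
     \<lparr>pc = 0, regs = (\<lambda>_. 0), mem = (\<lambda>i. if i < length xs then xs ! i else 0)\<rparr>"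

text \<open>The output is an array whose address is in register 0 and whose length is in register 1.\<close>

definition ram_output :: "ram_state \<Rightarrow> nat list" where
  "ram_output s = map (\<lambda>i. mem s (regs s 0 + i)) [0..<regs s 1]"

text \<open>With word length \<open>w\<close>, program \<open>P\<close> halts on input \<open>xs\<close> after exactly \<open>k\<close> steps with output \<open>ys\<close>.\<close>

definition computes_in :: "nat \<Rightarrow> instr list \<Rightarrow> nat list \<Rightarrow> nat \<Rightarrow> nat list \<Rightarrow> bool" where
  "computes_in w P xs k ys \<longleftrightarrow>
     (let s = \<lambda>j. (step w P ^^ j) (init_state xs)
      in (\<forall>j<k. \<not> halted P (s j)) \<and> halted P (s k) \<and> ram_output (s k) = ys)"

text \<open>
  The vertices are numbered \<open>0, ..., n - 1\<close> and the nodes of the host tree \<open>0, ..., m - 1\<close>, in an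
  arbitrary order.
\<close>

definition encode_rdv :: "nat \<Rightarrow> nat rtree \<Rightarrow> (nat \<Rightarrow> nat) \<Rightarrow> (nat \<Rightarrow> nat) \<Rightarrow> nat list" where
  "encode_rdv n T t b =
     (let m = card (nodes T)
      in [n, m, root_node T] @ map (parent T) [0..<m] @ map t [0..<n] @ map b [0..<n])"

end

theory Submission
  imports Defs
begin

text \<open>
  Walking down the host path gives every node its position, so that every vertex becomes an
  interval \<open>[L z, R z]\<close> of positions. Sweeping over the positions \<open>p\<close>, whenever a vertex \<open>a\<close> with
  \<open>R a = p\<close> is not yet dominated, one chooses the vertex \<open>u\<close> with \<open>L u \<le> p\<close> whose right end is
  largest. A vertex \<open>y\<close> with \<open>R y = p\<close> is undominated iff \<open>L y\<close> exceeds the largest right end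
  chosen so far, so it suffices to know, for each \<open>p\<close>, the largest \<open>L y\<close> with \<open>R y = p\<close> and the
  largest \<open>R u\<close> with \<open>L u = p\<close>; no sorting is needed. No vertex dominates two of the vertices \<open>a\<close>
  that forced a choice, whence the chosen set is minimum.
\<close>

section \<open>Structured programs for the word RAM\<close>

datatype com =
    Block "instr list"
  | Seq com com (infixr ";;" 60)
  | IfLess reg reg com
  | WhileLess reg reg com

primrec code_size :: "com \<Rightarrow> nat" where
  "code_size (Block is) = length is"
| "code_size (c ;; d) = code_size c + code_size d"
| "code_size (IfLess a b c) = code_size c + 2"
| "code_size (WhileLess a b c) = code_size c + 3"

text \<open>Jump targets are absolute, so the code depends on the address \<open>l\<close> at which it is placed.\<close>

primrec compile :: "nat \<Rightarrow> com \<Rightarrow> instr list" where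
  "compile l (Block is) = is"
| "compile l (c ;; d) = compile l c @ compile (l + code_size c) d"
| "compile l (IfLess a b c) =
     [JumpLess a b (l + 2), Jump (l + 2 + code_size c)] @ compile (l + 2) c"
| "compile l (WhileLess a b c) =
     [JumpLess a b (l + 2), Jump (l + 3 + code_size c)] @ compile (l + 2) c @ [Jump l]"

lemma length_compile [simp]: "length (compile l c) = code_size c"
  by (induction c arbitrary: l) simp_all

definition code_at :: "instr list \<Rightarrow> nat \<Rightarrow> instr list \<Rightarrow> bool" where
  "code_at P l is \<longleftrightarrow> (\<exists>xs ys. P = xs @ is @ ys \<and> length xs = l)"

lemma code_at_append:
  assumes "code_at P l (is @ js)"
  shows "code_at P l is" and "code_at P (l + length is) js"
proof -
  obtain xs ys where "P = xs @ (is @ js) @ ys" "length xs = l"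
    using assms by (auto simp: code_at_def)
  then have "P = xs @ is @ (js @ ys) \<and> length xs = l"
    and "P = (xs @ is) @ js @ ys \<and> length (xs @ is) = l + length is"
    by simp_all
  then show "code_at P l is" and "code_at P (l + length is) js"
    unfolding code_at_def by blast+
qed

lemma code_at_Cons:
  assumes "code_at P l (i # is)"
  shows "l < length P" and "P ! l = i" and "code_at P (Suc l) is"
proof -
  have "code_at P l ([i] @ is)"
    using assms by simp
  from code_at_append(2)[OF this] show "code_at P (Suc l) is"
    by simp
  show "l < length P" "P ! l = i"
    using assms by (auto simp: code_at_def nth_append)
qed

text \<open>Only the states before the last must be live, as in \<open>computes_in\<close>; so exact
  step counts add up under composition.\<close>

definition reaches :: "nat \<Rightarrow> instr list \<Rightarrow> ram_state \<Rightarrow> nat \<Rightarrow> ram_state \<Rightarrow> bool" where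
  "reaches w P s k s' \<longleftrightarrow>
     (step w P ^^ k) s = s' \<and> (\<forall>j<k. \<not> halted P ((step w P ^^ j) s))"

lemma reaches_refl: "reaches w P s 0 s"
  by (simp add: reaches_def)

lemma reaches_trans:
  assumes "reaches w P s j s'" and "reaches w P s' k s''"
  shows "reaches w P s (j + k) s''"
  unfolding reaches_def
proof (intro conjI allI impI)
  have shift: "(step w P ^^ (i + j)) s = (step w P ^^ i) s'" for i
    using assms(1) by (simp add: reaches_def funpow_add)
  show "(step w P ^^ (j + k)) s = s''"
    using shift[of k] assms(2) by (simp add: reaches_def add.commute)
  fix i assume "i < j + k"
  show "\<not> halted P ((step w P ^^ i) s)"
  proof (cases "i < j")
    case True
    then show ?thesis using assms(1) by (simp add: reaches_def)
  next
    case False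
    then show ?thesis
      using shift[of "i - j"] assms(2) \<open>i < j + k\<close> by (simp add: reaches_def)
  qed
qed

lemma reaches_step:
  assumes "code_at P (pc s) (i # is)" and "i \<noteq> Halt"
  shows "reaches w P s 1 (exec w i s)"
  using code_at_Cons[OF assms(1)] assms(2) by (simp add: reaches_def halted_def step_def)

section \<open>Time-bounded specifications of structured code\<close>

primrec straight :: "instr \<Rightarrow> bool" where
  "straight (Const r c) = True"
| "straight (Move r r1) = True"
| "straight (Bin f r r1 r2) = True"
| "straight (Load r a) = True"
| "straight (Store a r) = True"
| "straight (Jump l) = False"
| "straight (JumpEq r1 r2 l) = False"
| "straight (JumpLess r1 r2 l) = False"
| "straight Halt = False"

type_synonym store = "(reg \<Rightarrow> nat) \<times> (nat \<Rightarrow> nat)"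

fun effect :: "nat \<Rightarrow> instr \<Rightarrow> store \<Rightarrow> store" where
  "effect w (Const r c) (g, h) = (g(r := take_bit w c), h)"
| "effect w (Move r r1) (g, h) = (g(r := g r1), h)"
| "effect w (Bin f r r1 r2) (g, h) = (g(r := binop_val w f (g r1) (g r2)), h)"
| "effect w (Load r a) (g, h) = (g(r := h (g a)), h)"
| "effect w (Store a r) (g, h) = (g, h(g a := g r))"
| "effect w _ (g, h) = (g, h)"

abbreviation store_of :: "ram_state \<Rightarrow> store" where
  "store_of s \<equiv> (regs s, mem s)"

lemma exec_straight:
  assumes "straight i"
  shows "pc (exec w i s) = Suc (pc s)" and "store_of (exec w i s) = effect w i (store_of s)"
  using assms by (cases i; simp add: set_reg_def)+

text \<open>A total-correctness triple with a time bound. Quantifying over every program that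
  contains the code at the current address is what makes fragments composable.\<close>

definition spec :: "nat \<Rightarrow> com \<Rightarrow> store \<Rightarrow> nat \<Rightarrow> (store \<Rightarrow> bool) \<Rightarrow> bool" where
  "spec w c \<sigma> k Q \<longleftrightarrow>
     (\<forall>P s. code_at P (pc s) (compile (pc s) c) \<longrightarrow> store_of s = \<sigma> \<longrightarrow>
        (\<exists>j s'. j \<le> k \<and> reaches w P s j s' \<and> pc s' = pc s + code_size c \<and> Q (store_of s')))"

lemma specI:
  assumes "\<And>P s. code_at P (pc s) (compile (pc s) c) \<Longrightarrow> store_of s = \<sigma> \<Longrightarrow>
    \<exists>j s'. j \<le> k \<and> reaches w P s j s' \<and> pc s' = pc s + code_size c \<and> Q (store_of s')"
  shows "spec w c \<sigma> k Q"
  using assms by (simp add: spec_def)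

lemma specE:
  assumes "spec w c \<sigma> k Q" and "code_at P (pc s) (compile (pc s) c)" and "store_of s = \<sigma>"
  obtains j s' where "j \<le> k" "reaches w P s j s'" "pc s' = pc s + code_size c" "Q (store_of s')"
  using assms unfolding spec_def by blast

lemma spec_weaken: "spec w c \<sigma> k Q \<Longrightarrow> k \<le> k' \<Longrightarrow> spec w c \<sigma> k' Q"
  by (rule specI, erule specE) (auto intro: le_trans)

lemma spec_mono: "spec w c \<sigma> k Q \<Longrightarrow> (\<And>\<sigma>'. Q \<sigma>' \<Longrightarrow> Q' \<sigma>') \<Longrightarrow> spec w c \<sigma> k Q'"
  by (rule specI, erule specE) auto

lemma spec_Block:
  assumes "list_all straight is" and "Q (fold (effect w) is \<sigma>)"
  shows "spec w (Block is) \<sigma> (length is) Q"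
proof (rule specI)
  have "\<exists>s'. reaches w P s (length is) s' \<and> pc s' = pc s + length is \<and>
      store_of s' = fold (effect w) is (store_of s)"
    if "code_at P (pc s) is" and "list_all straight is" for P s
    using that
  proof (induction "is" arbitrary: s)
    case Nil
    then show ?case using reaches_refl by auto
  next
    case (Cons i "is")
    let ?s = "exec w i s"
    have i: "straight i" using Cons.prems by simp
    then have "i \<noteq> Halt" by auto
    then have 1: "reaches w P s 1 ?s"
      using Cons.prems(1) by (rule reaches_step[rotated])
    have "code_at P (pc ?s) is"
      using code_at_Cons(3)[OF Cons.prems(1)] exec_straight(1)[OF i] by simp
    then obtain s' where "reaches w P ?s (length is) s'" "pc s' = pc ?s + length is"
      "store_of s' = fold (effect w) is (store_of ?s)"
      using Cons by auto
    then show ?case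
      using reaches_trans[OF 1] exec_straight[OF i, of w s] by (intro exI[of _ s']) simp
  qed
  then show "\<exists>j s'. j \<le> length is \<and> reaches w P s j s' \<and>
      pc s' = pc s + code_size (Block is) \<and> Q (store_of s')"
    if "code_at P (pc s) (compile (pc s) (Block is))" "store_of s = \<sigma>" for P s
    using that assms by (metis code_size.simps(1) compile.simps(1) order_refl)
qed

lemma spec_Seq:
  assumes "spec w c \<sigma> j P" and "\<And>\<sigma>'. P \<sigma>' \<Longrightarrow> spec w d \<sigma>' k Q"
  shows "spec w (c ;; d) \<sigma> (j + k) Q"
proof (rule specI)
  fix p s
  assume code: "code_at p (pc s) (compile (pc s) (c ;; d))" and s: "store_of s = \<sigma>"
  note code = code_at_append[OF code[unfolded compile.simps], simplified]
  obtain i s' where 1: "i \<le> j" "reaches w p s i s'" "pc s' = pc s + code_size c"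
    "P (store_of s')"
    using specE[OF assms(1) code(1) s] .
  obtain i' s'' where "i' \<le> k" "reaches w p s' i' s''" "pc s'' = pc s' + code_size d"
    "Q (store_of s'')"
    using specE[OF assms(2)[OF 1(4)]] code(2) 1(3) by metis
  then show "\<exists>i s'. i \<le> j + k \<and> reaches w p s i s' \<and> pc s' = pc s + code_size (c ;; d) \<and>
      Q (store_of s')"
    using 1 reaches_trans by (intro exI[of _ "i + i'"] exI[of _ s'']) auto
qed

text \<open>A failing test costs one step more, since it falls through to the
  \<open>Jump\<close>.\<close>

lemma reaches_test:
  assumes "code_at P (pc s) ([JumpLess a b (pc s + 2), Jump l] @ is)"
  shows "regs s a < regs s b \<Longrightarrow> reaches w P s 1 (s\<lparr>pc := pc s + 2\<rparr>)"
    and "\<not> regs s a < regs s b \<Longrightarrow> reaches w P s 2 (s\<lparr>pc := l\<rparr>)"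
proof -
  have 1: "reaches w P s 1 (exec w (JumpLess a b (pc s + 2)) s)"
    using assms by (intro reaches_step) simp_all
  then show "regs s a < regs s b \<Longrightarrow> reaches w P s 1 (s\<lparr>pc := pc s + 2\<rparr>)"
    by simp
  assume "\<not> regs s a < regs s b"
  with 1 have 1: "reaches w P s 1 (s\<lparr>pc := Suc (pc s)\<rparr>)"
    by simp
  have "code_at P (Suc (pc s)) (Jump l # is)"
    using assms code_at_Cons(3) by force
  then have "reaches w P (s\<lparr>pc := Suc (pc s)\<rparr>) 1 (exec w (Jump l) (s\<lparr>pc := Suc (pc s)\<rparr>))"
    by (intro reaches_step) simp_all
  from reaches_trans[OF 1 this] show "reaches w P s 2 (s\<lparr>pc := l\<rparr>)"
    by (simp add: numeral_2_eq_2)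
qed

lemma spec_IfLess:
  assumes "fst \<sigma> a < fst \<sigma> b \<Longrightarrow> spec w c \<sigma> k Q" and "\<not> fst \<sigma> a < fst \<sigma> b \<Longrightarrow> Q \<sigma>"
  shows "spec w (IfLess a b c) \<sigma> (k + 2) Q"
proof (rule specI)
  fix P s
  assume code: "code_at P (pc s) (compile (pc s) (IfLess a b c))" and s: "store_of s = \<sigma>"
  note test = reaches_test[OF code[unfolded compile.simps], of w]
  show "\<exists>j s'. j \<le> k + 2 \<and> reaches w P s j s' \<and> pc s' = pc s + code_size (IfLess a b c) \<and>
      Q (store_of s')"
  proof (cases "fst \<sigma> a < fst \<sigma> b")
    case True
    let ?s = "s\<lparr>pc := pc s + 2\<rparr>"
    have "code_at P (pc ?s) (compile (pc ?s) c)"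
      using code_at_append(2)[OF code[unfolded compile.simps]] by simp
    then obtain j s' where "j \<le> k" "reaches w P ?s j s'" "pc s' = pc ?s + code_size c"
      "Q (store_of s')"
      using specE[OF assms(1)[OF True], of P ?s] s by auto
    moreover have "reaches w P s 1 ?s"
      using test(1) True s by auto
    ultimately show ?thesis
      using reaches_trans[of w P s 1 ?s j s'] by (intro exI[of _ "1 + j"] exI[of _ s']) auto
  next
    case False
    then show ?thesis
      using test(2) assms(2) s
      by (intro exI[of _ 2] exI[of _ "s\<lparr>pc := pc s + 2 + code_size c\<rparr>"]) auto
  qed
qed

text \<open>The guard is tied to the counter \<open>i\<close>, so the body runs exactly
  \<open>N\<close> times. A round pays one step for the test and one for the jump back; the final
  failing test pays two.\<close>

lemma spec_WhileLess:
  assumes "I 0 \<sigma>"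
    and guard: "\<And>i g h. I i (g, h) \<Longrightarrow> g a < g b \<longleftrightarrow> i < N"
    and body: "\<And>i g h. i < N \<Longrightarrow> I i (g, h) \<Longrightarrow> spec w c (g, h) k (I (Suc i))"
  shows "spec w (WhileLess a b c) \<sigma> (N * (k + 2) + 2) (I N)"
proof -
  \<comment> \<open>Induction on the number \<open>d\<close> of rounds still to come.\<close>
  have "spec w (WhileLess a b c) \<sigma> (d * (k + 2) + 2) (I N)" if "d \<le> N" "I (N - d) \<sigma>" for d \<sigma>
    using that
  proof (induction d arbitrary: \<sigma>)
    case 0
    show ?case
    proof (rule specI)
      fix P s
      assume code: "code_at P (pc s) (compile (pc s) (WhileLess a b c))" and s: "store_of s = \<sigma>"
      have "\<not> regs s a < regs s b"
        using guard[of N "regs s" "mem s"] 0 s by auto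
      then show "\<exists>j s'. j \<le> 0 * (k + 2) + 2 \<and> reaches w P s j s' \<and>
          pc s' = pc s + code_size (WhileLess a b c) \<and> I N (store_of s')"
        using reaches_test(2)[OF code[unfolded compile.simps], of w] 0 s
        by (intro exI[of _ 2] exI[of _ "s\<lparr>pc := pc s + 3 + code_size c\<rparr>"]) auto
    qed
  next
    case (Suc d)
    show ?case
    proof (rule specI)
      fix P s
      assume code: "code_at P (pc s) (compile (pc s) (WhileLess a b c))" and s: "store_of s = \<sigma>"
      let ?s = "s\<lparr>pc := pc s + 2\<rparr>"
      note split = code_at_append[OF code_at_append(2)[OF code[unfolded compile.simps]]]
      have "Suc (N - Suc d) = N - d"
        using Suc.prems by simp
      then have b: "fst \<sigma> a < fst \<sigma> b" "spec w c \<sigma> k (I (N - d))"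
        using guard[of "N - Suc d" "fst \<sigma>" "snd \<sigma>"] body[of "N - Suc d" "fst \<sigma>" "snd \<sigma>"]
          Suc.prems by auto
      have 1: "reaches w P s 1 ?s"
        using reaches_test(1)[OF code[unfolded compile.simps], of w] b(1) s by auto
      obtain j s' where 2: "j \<le> k" "reaches w P ?s j s'" "pc s' = pc ?s + code_size c"
        "I (N - d) (store_of s')"
        using specE[OF b(2), of P ?s] split(1) s by auto
      let ?s' = "s'\<lparr>pc := pc s\<rparr>"
      have "code_at P (pc s') [Jump (pc s)]"
        using split(2) 2(3) by simp
      then have 3: "reaches w P s' 1 ?s'"
        using reaches_step[of P s' "Jump (pc s)"] by simp
      have "spec w (WhileLess a b c) (store_of ?s') (d * (k + 2) + 2) (I N)"
        using Suc.IH[of "store_of ?s'"] Suc.prems(1) 2(4) by simp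
      from specE[OF this, of P ?s'] obtain i s'' where 4: "i \<le> d * (k + 2) + 2"
        "reaches w P ?s' i s''" "pc s'' = pc s + code_size (WhileLess a b c)" "I N (store_of s'')"
        using code by auto
      have "reaches w P s (1 + j + 1 + i) s''"
        using 1 2(2) 3 4(2) reaches_trans by blast
      then show "\<exists>j s'. j \<le> Suc d * (k + 2) + 2 \<and> reaches w P s j s' \<and>
          pc s' = pc s + code_size (WhileLess a b c) \<and> I N (store_of s')"
        using 2(1) 4 by (intro exI[of _ "1 + j + 1 + i"] exI[of _ s'']) auto
    qed
  qed
  from this[of N] show ?thesis
    using assms(1) by simp
qed

text \<open>Weakest preconditions for loop-free code, to be evaluated by simplification; loops are
  refused because they need an invariant.\<close>

primrec vc :: "nat \<Rightarrow> com \<Rightarrow> (store \<Rightarrow> bool) \<Rightarrow> store \<Rightarrow> bool" where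
  "vc w (Block is) Q \<sigma> \<longleftrightarrow> list_all straight is \<and> Q (fold (effect w) is \<sigma>)"
| "vc w (c ;; d) Q \<sigma> \<longleftrightarrow> vc w c (vc w d Q) \<sigma>"
| "vc w (IfLess a b c) Q \<sigma> \<longleftrightarrow> (if fst \<sigma> a < fst \<sigma> b then vc w c Q \<sigma> else Q \<sigma>)"
| "vc w (WhileLess a b c) Q \<sigma> \<longleftrightarrow> False"

text \<open>Without loops each instruction runs at most once, so the code length bounds the
  time.\<close>

lemma spec_vc: "vc w c Q \<sigma> \<Longrightarrow> spec w c \<sigma> (code_size c) Q"
proof (induction c arbitrary: Q \<sigma>)
  case (Block "is")
  then show ?case using spec_Block by simp
next
  case (Seq c d)
  then show ?case
    using spec_Seq[OF Seq.IH(1) Seq.IH(2)] by simp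
next
  case (IfLess a b c)
  then show ?case
    using spec_IfLess[of \<sigma> a b w c "code_size c" Q] by (auto split: if_splits)
qed simp

text \<open>Execution ends with the program counter just behind the code, which
  \<open>halted\<close> accepts as final.\<close>

lemma spec_computes_in:
  assumes "spec w c ((\<lambda>_. 0), mem (init_state xs)) k
      (\<lambda>(g, h). Q (map (\<lambda>i. h (g 0 + i)) [0..<g 1]))"
  shows "\<exists>j ys. computes_in w (compile 0 c) xs j ys \<and> j \<le> k \<and> Q ys"
proof -
  let ?s = "init_state xs"
  have s: "pc ?s = 0" "store_of ?s = ((\<lambda>_. 0), mem ?s)"
    by (simp_all add: init_state_def)
  have code: "code_at (compile 0 c) (pc ?s) (compile (pc ?s) c)"
    using s(1) by (auto simp: code_at_def)
  obtain j s' where "j \<le> k" "reaches w (compile 0 c) ?s j s'" "pc s' = code_size c"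
    "Q (ram_output s')"
    using specE[OF assms code s(2)] s(1) by (auto simp: ram_output_def)
  then show ?thesis
    by (intro exI[of _ j] exI[of _ "ram_output s'"])
      (auto simp: computes_in_def reaches_def halted_def)
qed


section \<open>The greedy sweep\<close>

text \<open>An empty bucket has the value 0 of cleared memory; the recursion follows the loop over
  the vertices.\<close>

primrec bucket_max :: "(nat \<Rightarrow> nat) \<Rightarrow> (nat \<Rightarrow> nat) \<Rightarrow> nat \<Rightarrow> nat \<Rightarrow> nat" where
  "bucket_max f g 0 l = 0"
| "bucket_max f g (Suc i) l =
     (if f i = l then max (bucket_max f g i l) (g i) else bucket_max f g i l)"

lemma bucket_max_ge: "z < i \<Longrightarrow> g z \<le> bucket_max f g i (f z)"
  by (induction i) (auto simp: less_Suc_eq le_max_iff_disj)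

lemma bucket_max_attained:
  "bucket_max f g i l = 0 \<or> (\<exists>z<i. f z = l \<and> bucket_max f g i l = g z)"
  by (induction i) (auto simp: less_Suc_eq max_def)

locale interval_family =
  fixes n m :: nat and L R :: "nat \<Rightarrow> nat"
  assumes interval: "z < n \<Longrightarrow> 0 < L z \<and> L z \<le> R z \<and> R z \<le> m"
begin

definition meet :: "nat \<Rightarrow> nat \<Rightarrow> bool" where
  "meet u v \<longleftrightarrow> L u \<le> R v \<and> L v \<le> R u"

text \<open>
  A maximum of keys determines a vertex with the largest right end: it is \<open>key u mod n\<close>, and its
  right end is \<open>key u div n\<close>. Right ends are positive, so keys are positive too and 0 can stand
  for ``no vertex''.
\<close>

definition key :: "nat \<Rightarrow> nat" where
  "key u = R u * n + u"

lemma key_div: "u < n \<Longrightarrow> key u div n = R u"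
  and key_mod: "u < n \<Longrightarrow> key u mod n = u"
  by (simp_all add: key_def)

lemma key_le: "u < n \<Longrightarrow> key u \<le> m * n + n"
  using interval[of u] by (auto simp: key_def intro!: add_mono mult_right_mono)

text \<open>
  The components are the largest key of a vertex with left end below the current position, the
  largest right end of a chosen vertex, and the chosen vertices.
\<close>

primrec sweep :: "nat \<Rightarrow> nat \<times> nat \<times> nat list" where
  "sweep 0 = (0, 0, [])"
| "sweep (Suc p) =
     (case sweep p of (k, c, us) \<Rightarrow>
        let k' = max k (bucket_max L key n p)
        in if c < bucket_max R L n p then (k', k' div n, us @ [k' mod n]) else (k', c, us))"

definition best_key :: "nat \<Rightarrow> nat \<Rightarrow> bool" where
  "best_key p k \<longleftrightarrow>
     (\<forall>u<n. L u < p \<longrightarrow> key u \<le> k) \<and> (k = 0 \<or> (\<exists>u<n. L u < p \<and> k = key u))"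

lemma best_key_Suc:
  assumes "best_key p k"
  shows "best_key (Suc p) (max k (bucket_max L key n p))"
proof -
  have "key u \<le> max k (bucket_max L key n p)" if "u < n" "L u < Suc p" for u
    using that assms bucket_max_ge[of u n key L]
    by (cases "L u = p") (auto simp: best_key_def le_max_iff_disj)
  moreover have "k = 0 \<or> (\<exists>u<n. L u < Suc p \<and> k = key u)"
    using assms less_Suc_eq unfolding best_key_def by blast
  ultimately show ?thesis
    using bucket_max_attained[of L key n p] unfolding best_key_def
    by (auto simp: max_def)
qed

text \<open>
  Each chosen vertex comes with the vertex \<open>a\<close> that forced the choice. Every neighbour of \<open>a\<close>
  ends at or before \<open>c\<close>, so no vertex dominates two of these.
\<close>

definition greedy :: "nat \<Rightarrow> nat \<Rightarrow> nat list \<Rightarrow> nat set \<Rightarrow> bool" where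
  "greedy p c us A \<longleftrightarrow>
     distinct us \<and> (\<forall>u\<in>set us. u < n \<and> R u \<le> c \<and> L u < p) \<and>
     (0 < c \<longrightarrow> (\<exists>u\<in>set us. R u = c)) \<and>
     (\<forall>y<n. R y < p \<longrightarrow> (\<exists>u\<in>set us. meet u y)) \<and>
     A \<subseteq> {..<n} \<and> card A = length us \<and>
     (\<forall>a\<in>A. \<forall>u<n. L u \<le> R a \<longrightarrow> R u \<le> c) \<and>
     (\<forall>a\<in>A. \<forall>a'\<in>A. a \<noteq> a' \<longrightarrow> \<not> (\<exists>u<n. meet u a \<and> meet u a'))"

text \<open>A vertex \<open>y\<close> ending at \<open>p\<close> has \<open>L y \<le> c\<close>, and
  some chosen \<open>u\<close> ends at \<open>c\<close> and starts before \<open>p\<close>, so the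
  two overlap.\<close>

lemma greedy_skip:
  assumes "greedy p c us A" and "bucket_max R L n p \<le> c"
  shows "greedy (Suc p) c us A"
proof -
  have "\<exists>u\<in>set us. meet u y" if y: "y < n" "R y < Suc p" for y
  proof (cases "R y = p")
    case True
    have "L y \<le> c"
      using bucket_max_ge[OF y(1), of L R] assms(2) True by simp
    \<comment> \<open>This gives \<open>0 < c\<close>, so \<open>c\<close> is the right end of a
      chosen vertex and not the initial 0.\<close>
    moreover have "0 < L y"
      using interval[OF y(1)] by simp
    ultimately obtain u where "u \<in> set us" "R u = c" "L u < p"
      using assms(1) unfolding greedy_def by (metis order_less_le_trans)
    then show ?thesis
      using \<open>L y \<le> c\<close> True by (intro bexI[of _ u]) (auto simp: meet_def)
  next
    case False
    then show ?thesis using assms(1) y unfolding greedy_def by simp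
  qed
  then show ?thesis
    using assms(1) unfolding greedy_def by (simp add: less_Suc_eq)
qed

text \<open>The vertex \<open>z\<close> with the largest left end among those ending at
  \<open>p\<close> forces the choice and joins \<open>A\<close>; \<open>u\<close>, read off the best
  key, reaches furthest among the vertices starting by \<open>p\<close>.\<close>

lemma greedy_choose:
  assumes g: "greedy p c us A" and k: "best_key (Suc p) k" and c: "c < bucket_max R L n p"
  shows "\<exists>A'. greedy (Suc p) (k div n) (us @ [k mod n]) A'"
proof -
  \<comment> \<open>A value above \<open>c\<close> cannot be the default 0, so the maximum is
    attained.\<close>
  obtain z where z: "z < n" "R z = p" "c < L z"
    using bucket_max_attained[of R L n p] c by auto
  have "0 < key z" "key z \<le> k"
    using interval[OF z(1)] z k by (auto simp: key_def best_key_def)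
  then obtain u where u: "u < n" "L u \<le> p" "k = key u"
    using k by (auto simp: best_key_def less_Suc_eq_le)
  have k_eq: "k div n = R u" "k mod n = u"
    using u key_div key_mod by auto
  \<comment> \<open>Keys compare right ends first, and division by \<open>n\<close> recovers
    them.\<close>
  have R_le: "R v \<le> R u" if "v < n" "L v \<le> p" for v
  proof -
    have "key v \<le> key u"
      using that u(3) k by (auto simp: best_key_def less_Suc_eq_le)
    then show ?thesis
      using div_le_mono[of "key v" "key u" n] key_div that(1) u(1) by simp
  qed
  \<comment> \<open>\<open>z\<close> is itself a candidate for \<open>u\<close> and lies wholly
    beyond \<open>c\<close>.\<close>
  have p: "p \<le> R u" "c < R u"
    using R_le[OF z(1)] interval[OF z(1)] z by auto
  have A: "A \<subseteq> {..<n}" "card A = length us" "\<And>a v. a \<in> A \<Longrightarrow> v < n \<Longrightarrow> L v \<le> R a \<Longrightarrow> R v \<le> c"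
    using g unfolding greedy_def by blast+
  \<comment> \<open>A vertex meeting \<open>a\<close> starts by \<open>R a\<close>, hence ends by
    \<open>c\<close>, before \<open>z\<close> begins.\<close>
  have no_common: "\<not> (meet v a \<and> meet v z)" if "a \<in> A" "v < n" for a v
    using A(3)[OF that] z(3) by (auto simp: meet_def)
  have "z \<notin> A"
    using A(3)[of z z] z interval[OF z(1)] by auto
  then have card: "card (insert z A) = Suc (length us)"
    using A(1,2) finite_subset[of A "{..<n}"] by simp
  have "\<exists>v\<in>insert u (set us). meet v y" if y: "y < n" "R y < Suc p" for y
  proof (cases "R y = p")
    case True
    then show ?thesis
      using u(2) p(1) interval[OF y(1)] by (auto simp: meet_def)
  next
    case False
    then show ?thesis using g y unfolding greedy_def by simp
  qed
  moreover have "u \<notin> set us"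
    using g p(2) unfolding greedy_def by (meson leD)
  moreover have "\<forall>v\<in>set us. v < n \<and> R v \<le> R u \<and> L v < Suc p" "distinct us"
    using g p(2) unfolding greedy_def by (auto intro: less_imp_le order_le_less_trans less_SucI)
  moreover have "\<forall>a\<in>insert z A. \<forall>v<n. L v \<le> R a \<longrightarrow> R v \<le> R u"
    using A(3) R_le z(2) p(2) by (auto intro: less_imp_le order_le_less_trans)
  moreover have "\<forall>a\<in>insert z A. \<forall>a'\<in>insert z A. a \<noteq> a' \<longrightarrow> \<not> (\<exists>v<n. meet v a \<and> meet v a')"
    using g no_common unfolding greedy_def by blast
  ultimately show ?thesis
    unfolding greedy_def k_eq using u A(1) z(1) card
    by (intro exI[of _ "insert z A"]) (auto simp: less_Suc_eq_le)
qed

text \<open>Both invariants go through one induction, since the choice at \<open>p\<close> relies on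
  a best key that already includes the left ends equal to \<open>p\<close>.\<close>

lemma sweep_invariant:
  assumes "sweep p = (k, c, us)"
  shows "best_key p k" and "\<exists>A. greedy p c us A"
proof -
  have "best_key p k \<and> (\<exists>A. greedy p c us A)"
    using assms
  proof (induction p arbitrary: k c us)
    case 0
    then have "best_key 0 k" "greedy 0 c us {}"
      by (auto simp: best_key_def greedy_def)
    then show ?case by blast
  next
    case (Suc p)
    obtain k0 c0 us0 where 0: "sweep p = (k0, c0, us0)"
      by (cases "sweep p")
    obtain A where inv: "best_key p k0" "greedy p c0 us0 A"
      using Suc.IH[OF 0] by blast
    note k = best_key_Suc[OF inv(1)]
    show ?case
      using greedy_skip[OF inv(2)] greedy_choose[OF inv(2) k] k Suc.prems 0
      by (auto simp: Let_def split: if_splits)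
  qed
  then show "best_key p k" "\<exists>A. greedy p c us A"
    by blast+
qed

text \<open>These bounds keep the running key and the output addresses within a word.\<close>

lemma sweep_bounds:
  assumes "sweep p = (k, c, us)"
  shows "k \<le> m * n + n" and "set us \<subseteq> {..<n}" and "length us \<le> n"
proof -
  show "k \<le> m * n + n"
    using sweep_invariant(1)[OF assms] key_le by (auto simp: best_key_def)
  have us: "distinct us" "set us \<subseteq> {..<n}"
    using sweep_invariant(2)[OF assms] by (auto simp: greedy_def)
  then show "set us \<subseteq> {..<n}" "length us \<le> n"
    using card_mono[of "{..<n}" "set us"] by (simp_all add: distinct_card)
qed

text \<open>Right ends are at most \<open>m\<close>, so after position \<open>m\<close> every vertex
  is dominated. Minimality is a packing bound: members of \<open>A\<close> have no common dominator,
  so a dominating set has at least \<open>card A = length us\<close> vertices.\<close>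

lemma sweep_minimum_dominating_set:
  assumes E: "\<And>u v. u < n \<Longrightarrow> v < n \<Longrightarrow> u \<noteq> v \<Longrightarrow> E u v \<longleftrightarrow> meet u v"
    and sweep: "sweep (Suc m) = (k, c, us)"
  shows "distinct us" and "minimum_dominating_set {..<n} E (set us)"
proof -
  obtain A where A: "greedy (Suc m) c us A"
    using sweep_invariant(2)[OF sweep] by blast
  then show "distinct us"
    by (simp add: greedy_def)
  have us: "set us \<subseteq> {..<n}"
    using sweep_bounds(2)[OF sweep] .
  have "\<exists>u\<in>set us. meet u y" if "y < n" for y
    using A interval[OF that] that by (auto simp: greedy_def)
  then have "dominating_set {..<n} E (set us)"
    unfolding dominating_set_def using us E by (metis lessThan_iff subset_iff)
  moreover have "card (set us) \<le> card S" if S: "dominating_set {..<n} E S" for S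
  proof -
    have "\<exists>u\<in>S. u < n \<and> meet u a" if "a \<in> A" for a
    proof -
      have a: "a < n" using that A by (auto simp: greedy_def)
      then have "meet a a" using interval[of a] by (auto simp: meet_def)
      then show ?thesis
        using S a E unfolding dominating_set_def by (metis lessThan_iff subset_iff)
    qed
    \<comment> \<open>A dominator chosen for each forcing vertex gives an injection of
      \<open>A\<close> into \<open>S\<close>.\<close>
    then obtain d where d: "\<And>a. a \<in> A \<Longrightarrow> d a \<in> S \<and> d a < n \<and> meet (d a) a"
      by metis
    have "inj_on d A"
      using d A unfolding greedy_def inj_on_def by metis
    moreover have "finite S"
      using S finite_subset unfolding dominating_set_def by blast
    ultimately have "card A \<le> card S"
      using d by (intro card_inj_on_le) auto
    then show ?thesis
      using A by (auto simp: greedy_def distinct_card)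
  qed
  ultimately show "minimum_dominating_set {..<n} E (set us)"
    by (simp add: minimum_dominating_set_def)
qed

end


section \<open>Host paths\<close>

locale host_path =
  fixes T :: "nat rtree" and m :: nat and xs :: "nat list"
  assumes tree: "rooted_tree T" and nodes: "nodes T = {..<m}"
    and distinct: "distinct xs" and set_xs: "set xs = {..<m}"
    and hd_xs: "xs \<noteq> []" "hd xs = root_node T"
    and parent_Suc: "Suc i < length xs \<Longrightarrow> parent T (xs ! Suc i) = xs ! i"
begin

lemma length_xs: "length xs = m"
  using distinct_card[OF distinct] set_xs by simp

lemma m_pos: "0 < m"
  using length_xs hd_xs(1) by auto

lemma root: "root_node T = xs ! 0"
  using hd_xs by (simp add: hd_conv_nth)

lemma nth_lt: "i < m \<Longrightarrow> xs ! i < m"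
  using nth_mem[of i xs] set_xs length_xs by auto

lemma nth_inj: "i < m \<Longrightarrow> j < m \<Longrightarrow> xs ! i = xs ! j \<longleftrightarrow> i = j"
  using distinct length_xs nth_eq_iff_index_eq by blast

lemma node_cases:
  assumes "v < m"
  obtains i where "i < m" "v = xs ! i"
  using assms set_xs length_xs by (metis in_set_conv_nth lessThan_iff)

text \<open>Counted from 1, so that 0 stays free as the default of empty buckets.\<close>

definition pos :: "nat \<Rightarrow> nat" where
  "pos v = Suc (inv_into {..<m} ((!) xs) v)"

lemma pos_nth: "i < m \<Longrightarrow> pos (xs ! i) = Suc i"
  using nth_inj by (simp add: pos_def inj_on_def)

lemma pos_le: "v < m \<Longrightarrow> pos v \<le> m"
  by (erule node_cases) (simp add: pos_nth)

lemma pos_pos: "0 < pos v"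
  by (simp add: pos_def)

text \<open>Truncated subtraction agrees with the root being its own parent: climbing past the root
  stays there.\<close>

lemma ancestor_nth: "i < m \<Longrightarrow> (parent T ^^ k) (xs ! i) = xs ! (i - k)"
proof (induction k)
  case (Suc k)
  show ?case
  proof (cases "i - k")
    case 0
    then show ?thesis
      using Suc tree by (simp add: rooted_tree_def root)
  next
    case (Suc j)
    then have "parent T (xs ! (i - k)) = xs ! j"
      using parent_Suc[of j] Suc.prems length_xs by simp
    then show ?thesis
      using Suc.IH Suc.prems Suc by (simp add: diff_Suc)
  qed
qed simp

lemma descendant_iff:
  assumes "u < m" and "v < m"
  shows "descendant T v u \<longleftrightarrow> pos u \<le> pos v"
proof -
  obtain i j where ij: "i < m" "j < m" "u = xs ! i" "v = xs ! j"
    using assms node_cases by metis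
  have "(\<exists>k. xs ! (j - k) = xs ! i) \<longleftrightarrow> i \<le> j"
  proof
    assume "i \<le> j"
    then show "\<exists>k. xs ! (j - k) = xs ! i"
      by (intro exI[of _ "j - i"]) simp
  qed (use ij nth_inj in \<open>auto simp: less_imp_diff_less\<close>)
  then show ?thesis
    using ij nth_lt by (simp add: descendant_def nodes ancestor_nth pos_nth)
qed

text \<open>The paths behave as intervals: when they overlap, the later of the two top nodes lies on
  both.\<close>

lemma downward_paths_meet_iff:
  assumes "u < m" "v < m" "u' < m" "v' < m"
    and "pos u \<le> pos v" and "pos u' \<le> pos v'"
  shows "downward_path T u v \<inter> downward_path T u' v' \<noteq> {} \<longleftrightarrow> pos u \<le> pos v' \<and> pos u' \<le> pos v"
proof -
  have path: "downward_path T u v = {x. x < m \<and> pos u \<le> pos x \<and> pos x \<le> pos v}"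
    if "u < m" "v < m" for u v
    using that descendant_iff by (auto simp: downward_path_def descendant_def nodes)
  show ?thesis
  proof
    assume "pos u \<le> pos v' \<and> pos u' \<le> pos v"
    then have "u' \<in> downward_path T u v \<inter> downward_path T u' v' \<or>
        u \<in> downward_path T u v \<inter> downward_path T u' v'"
      using assms path by auto
    then show "downward_path T u v \<inter> downward_path T u' v' \<noteq> {}"
      by blast
  qed (use assms path in auto)
qed

end

lemma host_path_exists:
  assumes "path_rooted_at_end T" and "nodes T = {..<m}"
  shows "\<exists>xs. host_path T m xs"
  using assms unfolding path_rooted_at_end_def host_path_def by metis


section \<open>The program\<close>

text \<open>
  Memory layout: the input occupies the cells \<open>0, ..., 2 + m + 2n\<close>. It is followed by three arrays
  of length \<open>m + 1\<close> (the child of each node; the maximal key for each left end; the maximal left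
  end for each right end) and by the output. Registers 0 and 6 to 11 hold the addresses of the
  arrays, and registers 2, 3, 4, 5 and 15 hold \<open>n\<close>, \<open>m\<close>, the root, 1 and \<open>m + 1\<close>. The parent of
  the root is replaced by the non-node \<open>m\<close>, so that the root is not entered as a child of itself.
  The parent array is later overwritten by the positions of the nodes.
\<close>

definition setup_code :: com where
  "setup_code = Block [
     Load 2 12, Const 5 1, Load 3 5, Const 4 2, Load 4 4, Const 6 3,
     Bin ADD 7 6 3, Bin ADD 8 7 2, Bin ADD 9 8 2, Bin ADD 15 3 5,
     Bin ADD 10 9 15, Bin ADD 11 10 15, Bin ADD 0 11 15,
     Bin ADD 13 6 4, Store 13 3]"

text \<open>Inverts the parent map; the entry \<open>m\<close> of the root directs its write to the
  spare last cell of the child array.\<close>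

definition child_code :: com where
  "child_code = Block [
     Bin ADD 13 6 12, Load 13 13, Bin ADD 13 9 13, Store 13 12, Bin ADD 12 12 5]"

text \<open>Register 14 is the current node and register 12 the number of nodes already
  passed.\<close>

definition walk_code :: com where
  "walk_code = Block [
     Bin ADD 13 6 14, Bin ADD 12 12 5, Store 13 12, Bin ADD 13 9 14, Load 14 13]"

text \<open>Registers 13, 14 and 16 receive the left end, right end and key of the vertex in
  register 12; the two tests raise the bucket maxima.\<close>

definition bucket_code :: com where
  "bucket_code =
     Block [
       Bin ADD 13 7 12, Load 13 13, Bin ADD 13 6 13, Load 13 13,
       Bin ADD 14 8 12, Load 14 14, Bin ADD 14 6 14, Load 14 14,
       Bin MUL 16 14 2, Bin ADD 16 16 12, Bin ADD 17 10 13, Load 18 17] ;;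
     IfLess 18 16 (Block [Store 17 16]) ;;
     Block [Bin ADD 17 11 14, Load 18 17] ;;
     IfLess 18 13 (Block [Store 17 13]) ;;
     Block [Bin ADD 12 12 5]"

text \<open>Registers 13 and 14 are the first two components of \<open>sweep\<close>; register 1,
  the output length, doubles as the write index.\<close>

definition sweep_code :: com where
  "sweep_code =
     Block [Bin ADD 17 10 12, Load 18 17] ;;
     IfLess 13 18 (Block [Move 13 18]) ;;
     Block [Bin ADD 17 11 12, Load 18 17] ;;
     IfLess 14 18 (Block [
       Bin MOD 16 13 2, Bin ADD 17 0 1, Store 17 16, Bin ADD 1 1 5, Bin DIV 14 13 2]) ;;
     Block [Bin ADD 12 12 5]"

text \<open>The last loop is bounded by \<open>m + 1\<close>, in register 15, because positions go
  up to \<open>m\<close>.\<close>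

definition program :: com where
  "program =
     setup_code ;; WhileLess 12 3 child_code ;;
     Block [Const 12 0, Move 14 4] ;; WhileLess 12 3 walk_code ;;
     Block [Const 12 0] ;; WhileLess 12 2 bucket_code ;;
     Block [Const 12 0, Const 13 0, Const 14 0] ;; WhileLess 12 15 sweep_code"

lemma code_sizes:
  "code_size setup_code = 15" "code_size child_code = 5" "code_size walk_code = 5"
  "code_size bucket_code = 21" "code_size sweep_code = 15"
  by (simp_all add: setup_code_def child_code_def walk_code_def bucket_code_def sweep_code_def)

text \<open>The first word bound covers all addresses: the input takes \<open>3 + m + 2 * n\<close>
  cells, the three arrays \<open>3 * m + 3\<close>, the output at most \<open>n\<close>. The second
  covers all keys, by \<open>key_le\<close>.\<close>

locale rdv_input = host_path T m xs + interval_family n m "\<lambda>z. pos (t z)" "\<lambda>z. pos (b z)"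
  for T m xs n t b +
  fixes w :: nat
  assumes t_lt: "z < n \<Longrightarrow> t z < m" and b_lt: "z < n \<Longrightarrow> b z < m"
    and addresses: "4 * m + 3 * n + 6 < 2 ^ w" and keys: "m * n + n < 2 ^ w"
begin

abbreviation "L \<equiv> \<lambda>z. pos (t z)"
abbreviation "R \<equiv> \<lambda>z. pos (b z)"

definition "child_base = 3 + m + n + n"
definition "key_base = child_base + Suc m"
definition "left_base = key_base + Suc m"
definition "out_base = left_base + Suc m"

lemmas base_defs = child_base_def key_base_def left_base_def out_base_def

section \<open>Invariants of the four loops\<close>

definition fixed_regs :: "(reg \<Rightarrow> nat) \<Rightarrow> bool" where
  "fixed_regs g \<longleftrightarrow> g 0 = out_base \<and> g 2 = n \<and> g 3 = m \<and> g 4 = xs ! 0 \<and> g 5 = 1 \<and> g 6 = 3 \<and>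
     g 7 = 3 + m \<and> g 8 = 3 + m + n \<and> g 9 = child_base \<and> g 10 = key_base \<and> g 11 = left_base \<and>
     g 15 = Suc m"

definition ends_stored :: "(nat \<Rightarrow> nat) \<Rightarrow> bool" where
  "ends_stored h \<longleftrightarrow> (\<forall>z<n. h (3 + m + z) = t z \<and> h (3 + m + n + z) = b z)"

text \<open>Untouched zeros serve as the initial bucket maxima, so the first two loops must preserve
  them.\<close>

definition clear_from :: "nat \<Rightarrow> (nat \<Rightarrow> nat) \<Rightarrow> bool" where
  "clear_from a h \<longleftrightarrow> (\<forall>x\<ge>a. h x = 0)"

text \<open>The contents of the parent array after \<open>setup_code\<close>.\<close>

definition up :: "nat \<Rightarrow> nat" where
  "up v = (if v = xs ! 0 then m else parent T v)"

lemma up_nth_Suc: "Suc i < m \<Longrightarrow> up (xs ! Suc i) = xs ! i"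
  using nth_inj[of "Suc i" 0] parent_Suc length_xs m_pos by (simp add: up_def)

lemma up_le: "v < m \<Longrightarrow> up v \<le> m"
  using tree nodes by (auto simp: up_def rooted_tree_def intro: less_imp_le)

text \<open>On a path no two nodes share a parent once that of the root is the non-node
  \<open>m\<close>; hence no child cell is written twice.\<close>

lemma up_inj: "inj_on up {..<m}"
proof (rule inj_onI, simp)
  fix u v
  assume "u < m" "v < m" and eq: "up u = up v"
  then obtain i j where ij: "i < m" "j < m" "u = xs ! i" "v = xs ! j"
    using node_cases by metis
  then have "i = j"
    using eq up_nth_Suc nth_lt nth_inj
    by (cases i; cases j) (auto simp: up_def[of "xs ! 0"] Suc_lessD dest!: Suc_lessD)
  then show "u = v"
    using ij by simp
qed

definition child_inv :: "nat \<Rightarrow> store \<Rightarrow> bool" where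
  "child_inv i = (\<lambda>(g, h). fixed_regs g \<and> g 1 = 0 \<and> g 12 = i \<and> ends_stored h \<and>
     clear_from key_base h \<and> (\<forall>v<m. h (3 + v) = up v) \<and> (\<forall>v<i. h (child_base + up v) = v))"

text \<open>Register 14 is constrained only while \<open>i < m\<close>, since the last node has no
  child to move to.\<close>

definition walk_inv :: "nat \<Rightarrow> store \<Rightarrow> bool" where
  "walk_inv i = (\<lambda>(g, h). fixed_regs g \<and> g 1 = 0 \<and> g 12 = i \<and> (i < m \<longrightarrow> g 14 = xs ! i) \<and>
     ends_stored h \<and> clear_from key_base h \<and> (\<forall>j<i. h (3 + xs ! j) = Suc j) \<and>
     (\<forall>j. Suc j < m \<longrightarrow> h (child_base + xs ! j) = xs ! Suc j))"

definition bucket_inv :: "nat \<Rightarrow> store \<Rightarrow> bool" where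
  "bucket_inv i = (\<lambda>(g, h). fixed_regs g \<and> g 1 = 0 \<and> g 12 = i \<and>
     ends_stored h \<and> (\<forall>v<m. h (3 + v) = pos v) \<and>
     (\<forall>l\<le>m. h (key_base + l) = bucket_max L key i l \<and> h (left_base + l) = bucket_max R L i l))"

definition sweep_inv :: "nat \<Rightarrow> store \<Rightarrow> bool" where
  "sweep_inv p = (\<lambda>(g, h). fixed_regs g \<and> g 12 = p \<and>
     (\<forall>l\<le>m. h (key_base + l) = bucket_max L key n l \<and> h (left_base + l) = bucket_max R L n l) \<and>
     (g 13, g 14, map (\<lambda>i. h (out_base + i)) [0..<g 1]) = sweep p)"

text \<open>Lets the modular arithmetic of the machine be read as ordinary arithmetic.\<close>

lemma take_bit_word:
  assumes "x \<le> 4 * m + 3 * n + 6 \<or> x \<le> m * n + n"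
  shows "take_bit w x = x"
  using assms addresses keys by (auto simp: take_bit_nat_eq_self)

lemma init_mem:
  defines "h \<equiv> mem (init_state (encode_rdv n T t b))"
  shows "h 0 = n" and "h (Suc 0) = m" and "h 2 = xs ! 0"
    and "v < m \<Longrightarrow> h (3 + v) = parent T v" and "ends_stored h" and "clear_from child_base h"
proof -
  let ?ps = "map (parent T) [0..<m]" and ?ts = "map t [0..<n]" and ?bs = "map b [0..<n]"
  have enc: "encode_rdv n T t b = n # m # xs ! 0 # ?ps @ ?ts @ ?bs"
    by (simp add: encode_rdv_def nodes root)
  have nth: "h (3 + x) = (?ps @ ?ts @ ?bs) ! x" if "x < m + n + n" for x
    using that by (simp add: h_def init_state_def enc numeral_3_eq_3)
  show "h 0 = n" "h (Suc 0) = m" "h 2 = xs ! 0"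
    by (simp_all add: h_def init_state_def enc)
  show "v < m \<Longrightarrow> h (3 + v) = parent T v"
    using nth[of v] by (simp add: nth_append)
  have "h (3 + m + z) = t z" "h (3 + m + n + z) = b z" if "z < n" for z
    using nth[of "m + z"] nth[of "m + n + z"] that by (simp_all add: nth_append add.assoc)
  then show "ends_stored h"
    by (simp add: ends_stored_def)
  show "clear_from child_base h"
    by (simp add: clear_from_def h_def init_state_def enc child_base_def)
qed

section \<open>Establishing and preserving the invariants\<close>

lemma spec_setup:
  "spec w setup_code ((\<lambda>_. 0), mem (init_state (encode_rdv n T t b))) (code_size setup_code)
     (child_inv 0)"
proof (rule spec_vc)
  define h where "h = mem (init_state (encode_rdv n T t b))"
  note h = init_mem[folded h_def]
  have lt: "xs ! 0 < m"
    using nth_lt[OF m_pos] .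
  let ?h = "h(3 + xs ! 0 := m)"
  \<comment> \<open>Two bits suffice for the constants 1, 2 and 3 loaded by the setup.\<close>
  have "2 \<le> w"
  proof (rule ccontr)
    assume "\<not> 2 \<le> w"
    then have "(2::nat) ^ w \<le> 2 ^ 2"
      by (intro power_increasing) auto
    then show False
      using addresses by simp
  qed
  moreover have "clear_from key_base ?h" "ends_stored ?h" "up (xs ! 0) = m"
    "\<forall>v<m. v \<noteq> xs ! 0 \<longrightarrow> h (3 + v) = up v"
    using h lt by (auto simp: clear_from_def ends_stored_def base_defs up_def)
  ultimately show "vc w setup_code (child_inv 0) ((\<lambda>_. 0), mem (init_state (encode_rdv n T t b)))"
    unfolding h_def[symmetric] using h(1-3) lt
    by (simp add: setup_code_def child_inv_def fixed_regs_def base_defs take_bit_word)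
qed

lemma spec_child:
  assumes "i < m" and inv: "child_inv i (g, h)"
  shows "spec w child_code (g, h) (code_size child_code) (child_inv (Suc i))"
proof (rule spec_vc)
  have g: "fixed_regs g" "g 1 = 0" "g 12 = i"
    and h: "ends_stored h" "clear_from key_base h" "\<forall>v<m. h (3 + v) = up v"
      "\<forall>v<i. h (child_base + up v) = v"
    using inv by (auto simp: child_inv_def)
  let ?h = "h(child_base + up i := i)"
  \<comment> \<open>So the new child entry spares the earlier ones.\<close>
  have "up v \<noteq> up i" if "v < i" for v
    using inj_onD[OF up_inj, of v i] that assms(1) by auto
  then have "ends_stored ?h" "clear_from key_base ?h" "\<forall>v<m. ?h (3 + v) = up v"
      "\<forall>v<Suc i. ?h (child_base + up v) = v"
    using h up_le[OF assms(1)]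
    by (auto simp: ends_stored_def clear_from_def base_defs less_Suc_eq)
  then show "vc w child_code (child_inv (Suc i)) (g, h)"
    using g h(3) assms(1) up_le[OF assms(1)]
    by (simp add: child_code_def child_inv_def fixed_regs_def base_defs take_bit_word)
qed

lemma spec_walk:
  assumes "i < m" and inv: "walk_inv i (g, h)"
  shows "spec w walk_code (g, h) (code_size walk_code) (walk_inv (Suc i))"
proof (rule spec_vc)
  have g: "fixed_regs g" "g 1 = 0" "g 12 = i" "g 14 = xs ! i"
    and h: "ends_stored h" "clear_from key_base h" "\<forall>j<i. h (3 + xs ! j) = Suc j"
      "\<forall>j. Suc j < m \<longrightarrow> h (child_base + xs ! j) = xs ! Suc j"
    using inv assms(1) by (auto simp: walk_inv_def)
  let ?h = "h(3 + xs ! i := Suc i)"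
  have "xs ! j \<noteq> xs ! i" if "j < i" for j
    using nth_inj[of j i] that assms(1) by auto
  then have "ends_stored ?h" "clear_from key_base ?h" "\<forall>j<Suc i. ?h (3 + xs ! j) = Suc j"
      "\<forall>j. Suc j < m \<longrightarrow> ?h (child_base + xs ! j) = xs ! Suc j"
    using h nth_lt[OF assms(1)]
    by (auto simp: ends_stored_def clear_from_def base_defs less_Suc_eq)
  then show "vc w walk_code (walk_inv (Suc i)) (g, h)"
    using g assms(1) nth_lt[OF assms(1)] h(4)
    by (simp add: walk_code_def walk_inv_def fixed_regs_def base_defs take_bit_word)
qed

lemma spec_bucket:
  assumes "i < n" and inv: "bucket_inv i (g, h)"
  shows "spec w bucket_code (g, h) (code_size bucket_code) (bucket_inv (Suc i))"
proof (rule spec_vc)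
  have ends: "L i \<le> m" "R i \<le> m" "t i < m" "b i < m"
    using assms(1) pos_le t_lt b_lt by auto
  \<comment> \<open>The machine forms the product before adding the index, so the product is bounded
    separately.\<close>
  have key: "R i * n + i = key i" "R i * n \<le> m * n" "key i \<le> m * n + n"
    using key_le[OF assms(1)] ends(2) by (auto simp: key_def)
  have g: "fixed_regs g" "g 1 = 0" "g 12 = i"
    and h: "ends_stored h" "\<forall>v<m. h (3 + v) = pos v"
      "\<forall>l\<le>m. h (key_base + l) = bucket_max L key i l \<and> h (left_base + l) = bucket_max R L i l"
    using inv by (auto simp: bucket_inv_def)
  have h': "h (3 + m + i) = t i" "h (3 + m + n + i) = b i" "h (3 + t i) = L i" "h (3 + b i) = R i"
    using h(1,2) assms(1) ends by (auto simp: ends_stored_def)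
  let ?A = "h (key_base + L i) < key i" and ?B = "h (left_base + R i) < L i"
  \<comment> \<open>The memory after the first and after both conditional stores.\<close>
  define h1 where "h1 = (if ?A then h(key_base + L i := key i) else h)"
  define h2 where "h2 = (if ?B then h1(left_base + R i := L i) else h1)"
  have "ends_stored h2" "\<forall>v<m. h2 (3 + v) = pos v"
    using h(1,2) ends by (simp_all add: h1_def h2_def ends_stored_def base_defs)
  moreover have "h2 (key_base + l) = bucket_max L key (Suc i) l"
      "h2 (left_base + l) = bucket_max R L (Suc i) l" if "l \<le> m" for l
    using h(3) ends that by (auto simp: h1_def h2_def base_defs max_def)
  ultimately have "bucket_inv (Suc i) (g', h2)" if "fixed_regs g'" "g' 1 = 0" "g' 12 = Suc i" for g'
    using that by (simp add: bucket_inv_def)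
  then show "vc w bucket_code (bucket_inv (Suc i)) (g, h)"
    using g h' assms(1) ends key
    by (cases ?A; cases ?B)
      (simp add: bucket_code_def fixed_regs_def base_defs take_bit_word h1_def h2_def)+
qed

lemma spec_sweep:
  assumes "p < Suc m" and inv: "sweep_inv p (g, h)"
  shows "spec w sweep_code (g, h) (code_size sweep_code) (sweep_inv (Suc p))"
proof (rule spec_vc)
  define us where "us = map (\<lambda>i. h (out_base + i)) [0..<g 1]"
  define k where "k = max (g 13) (bucket_max L key n p)"
  have g: "fixed_regs g" "g 12 = p"
    and h: "\<forall>l\<le>m. h (key_base + l) = bucket_max L key n l \<and>
      h (left_base + l) = bucket_max R L n l"
    and s: "sweep p = (g 13, g 14, us)"
    using inv by (auto simp: sweep_inv_def us_def)
  have s': "sweep (Suc p) = (if g 14 < bucket_max R L n p then (k, k div n, us @ [k mod n])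
      else (k, g 14, us))"
    using s by (simp add: k_def Let_def)
  \<comment> \<open>Keeps the next output address within the address bound.\<close>
  have len: "g 1 \<le> n"
    using sweep_bounds(3)[OF s] by (simp add: us_def)
  \<comment> \<open>In either branch \<open>k\<close> is the first component of
    \<open>sweep (Suc p)\<close>.\<close>
  have "k \<le> m * n + n"
    using sweep_bounds(1)[of "Suc p"] s' by (auto split: if_splits)
  then have k: "k div n \<le> m * n + n" "k mod n \<le> m * n + n"
    by (meson div_le_dividend mod_less_eq_dividend order_trans)+
  have h_p: "h (key_base + p) = bucket_max L key n p" "h (left_base + p) = bucket_max R L n p"
    using h assms(1) by auto
  show "vc w sweep_code (sweep_inv (Suc p)) (g, h)"
  proof (cases "g 13 < bucket_max L key n p")
    case True
    then have "k = bucket_max L key n p" by (simp add: k_def)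
    then show ?thesis
      using g h h_p s' len k assms(1) True
      by (simp add: sweep_code_def sweep_inv_def fixed_regs_def base_defs take_bit_word us_def
          del: sweep.simps)
  next
    case False
    then have "k = g 13" by (simp add: k_def)
    then show ?thesis
      using g h h_p s' len k assms(1) False
      by (simp add: sweep_code_def sweep_inv_def fixed_regs_def base_defs take_bit_word us_def
          del: sweep.simps)
  qed
qed

section \<open>Passing from loop to loop, and the total time\<close>

lemma sweep_inv_final:
  assumes E: "\<And>u v. u < n \<Longrightarrow> v < n \<Longrightarrow> u \<noteq> v \<Longrightarrow> E u v \<longleftrightarrow> meet u v"
    and inv: "sweep_inv (Suc m) (g, h)"
  shows "distinct (map (\<lambda>i. h (g 0 + i)) [0..<g 1])"
    and "minimum_dominating_set {..<n} E (set (map (\<lambda>i. h (g 0 + i)) [0..<g 1]))"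
proof -
  have "sweep (Suc m) = (g 13, g 14, map (\<lambda>i. h (g 0 + i)) [0..<g 1])"
    using inv by (simp add: sweep_inv_def fixed_regs_def del: sweep.simps)
  from sweep_minimum_dominating_set[OF E this]
  show "distinct (map (\<lambda>i. h (g 0 + i)) [0..<g 1])"
    "minimum_dominating_set {..<n} E (set (map (\<lambda>i. h (g 0 + i)) [0..<g 1]))"
    by blast+
qed

lemma child_inv_exit:
  assumes "child_inv m (g, h)"
  shows "walk_inv 0 (g(12 := 0, 14 := g 4), h)"
proof -
  have "h (child_base + xs ! j) = xs ! Suc j" if "Suc j < m" for j
    using assms up_nth_Suc[OF that] nth_lt[OF that] by (force simp: child_inv_def)
  then show ?thesis
    using assms by (simp add: child_inv_def walk_inv_def fixed_regs_def)
qed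

lemma walk_inv_exit:
  assumes "walk_inv m (g, h)"
  shows "bucket_inv 0 (g(12 := 0), h)"
proof -
  have "h (3 + v) = pos v" if "v < m" for v
  proof -
    obtain j where "j < m" "v = xs ! j"
      using \<open>v < m\<close> by (rule node_cases)
    then show ?thesis
      using assms by (simp add: walk_inv_def pos_nth)
  qed
  moreover have "h (key_base + l) = 0" "h (left_base + l) = 0" for l
    using assms by (simp_all add: walk_inv_def clear_from_def left_base_def)
  ultimately show ?thesis
    using assms by (simp add: walk_inv_def bucket_inv_def fixed_regs_def)
qed

lemma bucket_inv_exit:
  assumes "bucket_inv n (g, h)"
  shows "sweep_inv 0 (g(12 := 0, 13 := 0, 14 := 0), h)"
  using assms by (simp add: bucket_inv_def sweep_inv_def fixed_regs_def)

text \<open>A round costs its body plus 2, so the child, walk and sweep loops give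
  \<open>7 + 7 + 17 = 31\<close> per node and the bucket loop 23 per vertex. The 46 is 21 for the
  straight blocks, 8 for the four loop exits and 17 for the extra round of the sweep.\<close>

lemma spec_program:
  "spec w program ((\<lambda>_. 0), mem (init_state (encode_rdv n T t b))) (31 * m + 23 * n + 46)
     (sweep_inv (Suc m))"
proof -
  have child: "spec w (WhileLess 12 3 child_code) \<sigma> (m * (5 + 2) + 2) (child_inv m)"
    if "child_inv 0 \<sigma>" for \<sigma>
    using that
  proof (rule spec_WhileLess)
    fix i g h assume "child_inv i (g, h)"
    then show "g 12 < g 3 \<longleftrightarrow> i < m"
      by (simp add: child_inv_def fixed_regs_def)
    assume "i < m"
    with \<open>child_inv i (g, h)\<close> show "spec w child_code (g, h) 5 (child_inv (Suc i))"
      using spec_child code_sizes by metis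
  qed
  have walk: "spec w (WhileLess 12 3 walk_code) \<sigma> (m * (5 + 2) + 2) (walk_inv m)"
    if "walk_inv 0 \<sigma>" for \<sigma>
    using that
  proof (rule spec_WhileLess)
    fix i g h assume "walk_inv i (g, h)"
    then show "g 12 < g 3 \<longleftrightarrow> i < m"
      by (simp add: walk_inv_def fixed_regs_def)
    assume "i < m"
    with \<open>walk_inv i (g, h)\<close> show "spec w walk_code (g, h) 5 (walk_inv (Suc i))"
      using spec_walk code_sizes by metis
  qed
  have bucket: "spec w (WhileLess 12 2 bucket_code) \<sigma> (n * (21 + 2) + 2) (bucket_inv n)"
    if "bucket_inv 0 \<sigma>" for \<sigma>
    using that
  proof (rule spec_WhileLess)
    fix i g h assume "bucket_inv i (g, h)"
    then show "g 12 < g 2 \<longleftrightarrow> i < n"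
      by (simp add: bucket_inv_def fixed_regs_def)
    assume "i < n"
    with \<open>bucket_inv i (g, h)\<close> show "spec w bucket_code (g, h) 21 (bucket_inv (Suc i))"
      using spec_bucket code_sizes by metis
  qed
  have sweep: "spec w (WhileLess 12 15 sweep_code) \<sigma> (Suc m * (15 + 2) + 2) (sweep_inv (Suc m))"
    if "sweep_inv 0 \<sigma>" for \<sigma>
    using that
  proof (rule spec_WhileLess)
    fix p g h assume "sweep_inv p (g, h)"
    then show "g 12 < g 15 \<longleftrightarrow> p < Suc m"
      by (simp add: sweep_inv_def fixed_regs_def)
    assume "p < Suc m"
    with \<open>sweep_inv p (g, h)\<close> show "spec w sweep_code (g, h) 15 (sweep_inv (Suc p))"
      using spec_sweep code_sizes by metis
  qed
  have blocks:
    "child_inv m \<sigma> \<Longrightarrow> spec w (Block [Const 12 0, Move 14 4]) \<sigma> 2 (walk_inv 0)"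
    "walk_inv m \<sigma> \<Longrightarrow> spec w (Block [Const 12 0]) \<sigma> 1 (bucket_inv 0)"
    "bucket_inv n \<sigma> \<Longrightarrow> spec w (Block [Const 12 0, Const 13 0, Const 14 0]) \<sigma> 3 (sweep_inv 0)"
    for \<sigma>
    using spec_Block[of "[Const 12 0, Move 14 4]" "walk_inv 0" w \<sigma>]
      spec_Block[of "[Const 12 0]" "bucket_inv 0" w \<sigma>]
      spec_Block[of "[Const 12 0, Const 13 0, Const 14 0]" "sweep_inv 0" w \<sigma>]
      child_inv_exit walk_inv_exit bucket_inv_exit
    by (cases \<sigma>; simp add: eval_nat_numeral)+
  show ?thesis
    unfolding program_def
    by (rule spec_weaken, (rule spec_Seq spec_setup child walk bucket sweep blocks | assumption)+)
      (simp add: code_sizes)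
qed

end


section \<open>Word length and the final constants\<close>

lemma rdv_path_program:
  assumes rdv: "rdv_representation T t b {..<n} E" and path: "path_rooted_at_end T"
    and nodes: "nodes T = {..<m}"
    and w: "4 * m + 3 * n + 6 < 2 ^ w" "m * n + n < 2 ^ w"
  shows "\<exists>k ys. computes_in w (compile 0 program) (encode_rdv n T t b) k ys \<and>
    k \<le> 31 * m + 23 * n + 46 \<and> distinct ys \<and> minimum_dominating_set {..<n} E (set ys)"
proof -
  obtain xs where "host_path T m xs"
    using host_path_exists[OF path nodes] by blast
  then interpret host_path T m xs .
  have z: "t z < m" "b z < m" "pos (t z) \<le> pos (b z)" if "z < n" for z
    using that rdv descendant_iff unfolding rdv_representation_def nodes by auto
  interpret rdv_input T m xs n t b w
    by unfold_locales (use z pos_le pos_pos w in auto)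
  have E: "E u v \<longleftrightarrow> meet u v" if "u < n" "v < n" "u \<noteq> v" for u v
    using that rdv z downward_paths_meet_iff
    unfolding rdv_representation_def meet_def by auto
  let ?Q = "\<lambda>ys. distinct ys \<and> minimum_dominating_set {..<n} E (set ys)"
  have "spec w program ((\<lambda>_. 0), mem (init_state (encode_rdv n T t b))) (31 * m + 23 * n + 46)
      (\<lambda>(g, h). ?Q (map (\<lambda>i. h (g 0 + i)) [0..<g 1]))"
    using spec_program
    by (rule spec_mono) (use sweep_inv_final[OF E] in \<open>auto simp del: sweep.simps\<close>)
  from spec_computes_in[of w _ _ _ ?Q, OF this] show ?thesis
    by blast
qed

text \<open>As \<open>log 2 (n + 1)\<close> is at least 1, it may multiply the constant
  \<open>log 2 B\<close>; so logarithmic words hold numbers quadratic in \<open>n\<close>.\<close>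

lemma power_word_length_bound:
  assumes "0 < n" and "1 \<le> B" and "(2 + log 2 B) * log 2 (real n + 1) \<le> real w"
  shows "B * (real n + 1)\<^sup>2 \<le> 2 ^ w"
proof -
  have l: "1 \<le> log 2 (real n + 1)"
    using assms(1) by (simp add: le_log_iff)
  have "log 2 (B * (real n + 1)\<^sup>2) = log 2 B + 2 * log 2 (real n + 1)"
    using assms(2) by (simp add: log_mult log_nat_power)
  also have "\<dots> \<le> log 2 B * log 2 (real n + 1) + 2 * log 2 (real n + 1)"
    using l assms(2) mult_left_mono[OF l, of "log 2 B"] by simp
  also have "\<dots> \<le> real w"
    using assms(3) by (simp add: algebra_simps)
  finally have "B * (real n + 1)\<^sup>2 \<le> 2 powr real w"
    using assms(2) by (simp add: log_le_iff)
  then show ?thesis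
    by (simp add: powr_realpow)
qed

text \<open>The program is fixed before \<open>C\<close>, while \<open>\<alpha>\<close> may depend
  on \<open>C\<close> because addresses and keys grow with the host path. Using \<open>n + 1\<close>
  keeps the logarithm positive at \<open>n = 1\<close>.\<close>

theorem theorem3:
  shows "\<exists>P :: instr list. \<forall>C :: real. \<exists>\<alpha> :: real. \<forall>\<beta> :: real. \<exists>c :: real.
    \<forall>(n :: nat) (m :: nat) (w :: nat) E (T :: nat rtree) t b.
      interval_graph {..<n} E \<longrightarrow>
      rdv_representation T t b {..<n} E \<longrightarrow>
      path_rooted_at_end T \<longrightarrow>
      nodes T = {..<m} \<longrightarrow>
      real m \<le> C * real n \<longrightarrow>
      \<alpha> * log 2 (real n + 1) \<le> real w \<longrightarrow>
      real w \<le> \<beta> * log 2 (real n + 1) \<longrightarrow>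
      (\<exists>k ys. computes_in w P (encode_rdv n T t b) k ys \<and> real k \<le> c * real n \<and>
         distinct ys \<and> minimum_dominating_set {..<n} E (set ys))"
proof (rule exI[of _ "compile 0 program"], intro allI)
  fix C :: real
  show "\<exists>\<alpha> :: real. \<forall>\<beta> :: real. \<exists>c :: real.
    \<forall>(n :: nat) (m :: nat) (w :: nat) E (T :: nat rtree) t b.
      interval_graph {..<n} E \<longrightarrow> rdv_representation T t b {..<n} E \<longrightarrow> path_rooted_at_end T \<longrightarrow>
      nodes T = {..<m} \<longrightarrow> real m \<le> C * real n \<longrightarrow> \<alpha> * log 2 (real n + 1) \<le> real w \<longrightarrow>
      real w \<le> \<beta> * log 2 (real n + 1) \<longrightarrow>
      (\<exists>k ys. computes_in w (compile 0 program) (encode_rdv n T t b) k ys \<and> real k \<le> c * real n \<and>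
         distinct ys \<and> minimum_dominating_set {..<n} E (set ys))"
  \<comment> \<open>The factor \<open>4 * \<bar>C\<bar> + 10\<close> makes its product with
    \<open>(n + 1)^2\<close> exceed both quantities that must fit into a word when
    \<open>m \<le> \<bar>C\<bar> * n\<close>. In the time constant, 69 is \<open>23 + 46\<close>,
    with the additive 46 absorbed by \<open>n \<ge> 1\<close>.\<close>
  proof (rule exI[of _ "2 + log 2 (4 * \<bar>C\<bar> + 10)"], intro allI exI[of _ "31 * \<bar>C\<bar> + 69"] impI)
    fix \<beta> :: real and n m w :: nat and E and T :: "nat rtree" and t b
    assume rdv: "rdv_representation T t b {..<n} E" and path: "path_rooted_at_end T"
      and nodes: "nodes T = {..<m}" and m: "real m \<le> C * real n"
      and w: "(2 + log 2 (4 * \<bar>C\<bar> + 10)) * log 2 (real n + 1) \<le> real w"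
    \<comment> \<open>The root is a node, and \<open>m \<le> C * n\<close> then excludes
      \<open>n = 0\<close>.\<close>
    have "0 < m"
      using path nodes by (auto simp: path_rooted_at_end_def rooted_tree_def)
    then have n: "0 < n"
      using m by (cases n) auto
    have "C * real n \<le> \<bar>C\<bar> * real n"
      by (simp add: mult_right_mono)
    with m have m': "real m \<le> \<bar>C\<bar> * real n"
      by simp
    have bound: "(4 * \<bar>C\<bar> + 10) * (real n + 1)\<^sup>2 \<le> 2 ^ w"
      using power_word_length_bound[OF n _ w] by simp
    have sq: "(real n + 1)\<^sup>2 = real n * real n + 2 * real n + 1"
      by (simp add: power2_eq_square algebra_simps)
    have mn: "real m * real n \<le> \<bar>C\<bar> * (real n * real n)"
      using mult_right_mono[OF m', of "real n"] by simp
    have "0 \<le> \<bar>C\<bar> * real n" "0 \<le> \<bar>C\<bar> * (real n * real n)" "0 \<le> real n * real n"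
      by simp_all
    moreover have "(4 * \<bar>C\<bar> + 10) * (real n + 1)\<^sup>2 = 4 * (\<bar>C\<bar> * (real n * real n)) +
        8 * (\<bar>C\<bar> * real n) + 4 * \<bar>C\<bar> + 10 * (real n * real n) + 20 * real n + 10"
      unfolding sq by (simp add: algebra_simps)
    ultimately have "4 * real m + 3 * real n + 6 < 2 ^ w" "real m * real n + real n < 2 ^ w"
      using bound m' mn by linarith+
    then have "real (4 * m + 3 * n + 6) < real (2 ^ w)" "real (m * n + n) < real (2 ^ w)"
      by simp_all
    then have "4 * m + 3 * n + 6 < 2 ^ w" "m * n + n < 2 ^ w"
      unfolding of_nat_less_iff .
    from rdv_path_program[OF rdv path nodes this] obtain k ys
      where k: "k \<le> 31 * m + 23 * n + 46"
        and ys: "computes_in w (compile 0 program) (encode_rdv n T t b) k ys" "distinct ys"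
          "minimum_dominating_set {..<n} E (set ys)"
      by blast
    have "real k \<le> 31 * real m + 23 * real n + 46"
      using k by linarith
    also have "\<dots> \<le> (31 * \<bar>C\<bar> + 69) * real n"
      using m' n by (simp add: algebra_simps)
    finally show "\<exists>k ys. computes_in w (compile 0 program) (encode_rdv n T t b) k ys \<and>
        real k \<le> (31 * \<bar>C\<bar> + 69) * real n \<and> distinct ys \<and>
        minimum_dominating_set {..<n} E (set ys)"
      using ys by blast
  qed
qed

end
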